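(* Let $(\mathbb{X},\mathfrak{A},\mu)$ be a probability space and let $\{\mathfrak{A}_n\}_{n\in\mathbb{N}}$ be a sequence of $\sigma$-subalgebras of $\mathfrak{A}$ such that for every $f\in L^\infty(\mathfrak{A})$ the sequence $\mathcal{E}(f|\mathfrak{A}_n)$ converges almost everywhere as $n\to\infty$. Then $\mathfrak{A}_{\mu a.e.}$ is a $\sigma$-subalgebra of $\mathfrak{A}$, the family $\mathbb{D}$ has a minimum $\sigma$-subalgebra $\mathfrak{A}_{\perp a.e.}$, and $\mathfrak{A}_{\mu a.e.}=\mathfrak{A}_{\perp a.e.}$.
   Context: $\mathcal{E}(f|\mathfrak{B})$ denotes the conditional expectation of $f$ given the $\sigma$-subalgebra $\mathfrak{B}$ of $\mathfrak{A}$; $\langle f,h\rangle=\int fh\,d\mu$; $\chi_A$ is the characteristic function of $A$; "$A=B$ a.e." means $\mu(A\bigtriangleup B)=0$. For $A\in\mathfrak{A}$ put $\|A\|_{\mathfrak{B}}=\|\mathcal{E}(\chi_A|\mathfrak{B})\|_\infty$. A set $A\in\mathfrak{A}$ is uniformly covered by $\{\mathfrak{A}_n\}$ if there are $A_n\in\mathfrak{A}_n$ ($n\in\mathbb{N}$) with (i) $A=\bigcup_{N=1}^\infty\bigcap_{n\ge N}A_n=\bigcap_{N=1}^\infty\bigcup_{n\ge N}A_n$ a.e. and (ii) $\|A\setminus A_n\|_{\mathfrak{A}_n}\to0$ as $n\to\infty$. Define $$\mathfrak{A}_{\mu a.e.}=\{A\in\mathfrak{A}: A \text{ and } A^c \text{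 are uniformly covered by }\{\mathfrak{A}_n\}_{n\in\mathbb{N}}\}.$$ For $N\in\mathbb{N}$ let $C_N$ be the set of all functions $h=\sum_{k\ge N}\mathcal{E}(\chi_{B_k}|\mathfrak{A}_k)$, where the sets $B_k\in\mathfrak{A}$ are pairwise disjoint and only finitely many of them are nonempty. Let $W^{\perp a.e.}$ be the set of $f\in L^\infty(\mu)$ such that $\langle f,h_{N_k}\rangle\to0$ as $k\to\infty$ for every strictly increasing sequence $(N_k)$ of natural numbers and every choice of $h_{N_k}\in C_{N_k}$. For a $\sigma$-subalgebra $\mathfrak{B}$ of $\mathfrak{A}$ let $\mathcal{E}_{\mathfrak{B}}^{\perp}f=f-\mathcal{E}(f|\mathfrak{B})$, and let $\mathbb{D}$ be the family of all $\sigma$-subalgebras $\mathfrak{B}$ of $\mathfrak{A}$ such that $\mathcal{E}_{\mathfrak{B}}^{\perp}f\in W^{\perp a.e.}$ for all $f\in L^\infty(\mathfrak{A})$. A minimum of $\mathbb{D}$ is an element of $\mathbb{D}$ contained in every element of $\mathbb{D}$; when it exists it is denoted $\mathfrak{A}_{\perp a.e.}$. Convention: inclusions and equalities between $\sigma$-subalgebras are understood modulo $\mu$-null sets, i.e. $\mathfrak{B}\subset\mathfrak{C}$ means every set in $\mathfrak{B}$ is a.e. equal to some set in $\mathfrak{C}$. *)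

theory Defs
  imports "HOL-Probability.Probability"
begin

text \<open>
  A sub-sigma-algebra of \<open>M\<close> is given, as in the library, by a measure \<open>F\<close> with
  \<open>subalgebra M F\<close>; only \<open>space F\<close> and \<open>sets F\<close> matter, the measure always being that of \<open>M\<close>.
  Functions are real-valued, and \<open>real_cond_exp M F f\<close> is one chosen version of the
  conditional expectation. The choice affects \<open>C_set\<close> and \<open>cond_exp_perp\<close>
  only up to almost-everywhere equality, and the other notions not at all.
\<close>

definition Linf_norm :: "'a measure \<Rightarrow> ('a \<Rightarrow> real) \<Rightarrow> ereal" where
  "Linf_norm M f = esssup M (\<lambda>x. ereal \<bar>f x\<bar>)"

definition Linf :: "'a measure \<Rightarrow> ('a \<Rightarrow> real) set" where
  "Linf M = {f \<in> borel_measurable M. Linf_norm M f < \<infinity>}"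

definition ae_eq_set :: "'a measure \<Rightarrow> 'a set \<Rightarrow> 'a set \<Rightarrow> bool" where
  "ae_eq_set M A B \<longleftrightarrow> sym_diff A B \<in> null_sets M"

definition ae_included :: "'a measure \<Rightarrow> 'a set set \<Rightarrow> 'a set set \<Rightarrow> bool" where
  "ae_included M \<B> \<C> \<longleftrightarrow> (\<forall>B\<in>\<B>. \<exists>C\<in>\<C>. ae_eq_set M B C)"

definition ae_equal :: "'a measure \<Rightarrow> 'a set set \<Rightarrow> 'a set set \<Rightarrow> bool" where
  "ae_equal M \<B> \<C> \<longleftrightarrow> ae_included M \<B> \<C> \<and> ae_included M \<C> \<B>"

definition set_norm :: "'a measure \<Rightarrow> 'a measure \<Rightarrow> 'a set \<Rightarrow> ereal" where
  "set_norm M B A = Linf_norm M (real_cond_exp M B (indicator A))"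

definition uniformly_covered :: "'a measure \<Rightarrow> (nat \<Rightarrow> 'a measure) \<Rightarrow> 'a set \<Rightarrow> bool" where
  "uniformly_covered M F A \<longleftrightarrow>
    (\<exists>a. (\<forall>n. a n \<in> sets (F n)) \<and>
         ae_eq_set M A (\<Union>N. \<Inter>n\<in>{N..}. a n) \<and>
         ae_eq_set M A (\<Inter>N. \<Union>n\<in>{N..}. a n) \<and>
         (\<lambda>n. set_norm M (F n) (A - a n)) \<longlonglongrightarrow> 0)"

definition A_mu_ae :: "'a measure \<Rightarrow> (nat \<Rightarrow> 'a measure) \<Rightarrow> 'a set set" where
  "A_mu_ae M F =
    {A \<in> sets M. uniformly_covered M F A \<and> uniformly_covered M F (space M - A)}"

text \<open>The empty sets \<open>B k\<close> contribute only terms that vanish almost everywhere, so they are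
  omitted from the sum to make it finite.\<close>

definition C_set :: "'a measure \<Rightarrow> (nat \<Rightarrow> 'a measure) \<Rightarrow> nat \<Rightarrow> ('a \<Rightarrow> real) set" where
  "C_set M F N =
    {h. \<exists>B. (\<forall>k\<ge>N. B k \<in> sets M) \<and> disjoint_family_on B {N..} \<and>
            finite {k. N \<le> k \<and> B k \<noteq> {}} \<and>
            h = (\<lambda>x. \<Sum>k | N \<le> k \<and> B k \<noteq> {}. real_cond_exp M (F k) (indicator (B k)) x)}"

definition W_perp_ae :: "'a measure \<Rightarrow> (nat \<Rightarrow> 'a measure) \<Rightarrow> ('a \<Rightarrow> real) set" where
  "W_perp_ae M F =
    {f \<in> Linf M. \<forall>N h. strict_mono N \<longrightarrow> (\<forall>k. h k \<in> C_set M F (N k)) \<longrightarrow>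
       (\<lambda>k. \<integral>x. f x * h k x \<partial>M) \<longlonglongrightarrow> 0}"

definition cond_exp_perp :: "'a measure \<Rightarrow> 'a measure \<Rightarrow> ('a \<Rightarrow> real) \<Rightarrow> 'a \<Rightarrow> real" where
  "cond_exp_perp M B f = (\<lambda>x. f x - real_cond_exp M B f x)"

definition D_family :: "'a measure \<Rightarrow> (nat \<Rightarrow> 'a measure) \<Rightarrow> 'a measure set" where
  "D_family M F = {B. subalgebra M B \<and> (\<forall>f\<in>Linf M. cond_exp_perp M B f \<in> W_perp_ae M F)}"

definition is_ae_minimum :: "'a measure \<Rightarrow> 'a measure set \<Rightarrow> 'a measure \<Rightarrow> bool" where
  "is_ae_minimum M \<D> B \<longleftrightarrow> B \<in> \<D> \<and> (\<forall>C\<in>\<D>. ae_included M (sets B) (sets C))"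

end

theory Submission
  imports Defs
begin

text \<open>
  Put \<open>T f = lim \<E>(f|\<AA>\<^sub>n)\<close>. Testing \<open>W\<^sup>\<bottom>\<close> against single terms
  \<open>\<E>(\<chi>\<^sub>A|\<AA>\<^sub>n)\<close>, and using dominated convergence for the converse, shows that it is the kernel
  of \<open>T\<close>. By dominated convergence \<open>T\<close> is a positive self-adjoint projection fixing the constants. It is therefore the conditional expectation onto
  the \<open>\<sigma>\<close>-algebra of the sets with \<open>T \<chi>\<^sub>A = \<chi>\<^sub>A\<close>, which is then the minimum of \<open>\<DD>\<close>. A uniform
  cover of \<open>A\<close> gives \<open>T \<chi>\<^sub>A \<le> \<chi>\<^sub>A\<close>, hence equality as the integrals agree. Conversely, if
  \<open>T \<chi>\<^sub>A = \<chi>\<^sub>A\<close>, then the sets \<open>{\<E>(\<chi>\<^sub>A|\<AA>\<^sub>n) > \<epsilon>\<^sub>n}\<close> cover \<open>A\<close> uniformly for every \<open>\<epsilon>\<^sub>n \<rightarrow> 0\<close>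
  that tends to zero slowly enough.
\<close>

section \<open>Essential bounds, equality modulo null sets and rates of convergence\<close>

lemma (in prob_space) Linf_iff_AE_bounded:
  "f \<in> Linf M \<longleftrightarrow> f \<in> borel_measurable M \<and> (\<exists>c. AE x in M. \<bar>f x\<bar> \<le> c)"
proof safe
  assume "f \<in> Linf M"
  then have m: "f \<in> borel_measurable M" and lt: "esssup M (\<lambda>x. ereal \<bar>f x\<bar>) < \<infinity>"
    by (auto simp: Linf_def Linf_norm_def)
  show "f \<in> borel_measurable M" by fact
  obtain c where c: "esssup M (\<lambda>x. ereal \<bar>f x\<bar>) \<le> ereal c"
    using lt by (cases "esssup M (\<lambda>x. ereal \<bar>f x\<bar>)") auto
  have "AE x in M. \<bar>f x\<bar> \<le> c"
    using esssup_AE[of "\<lambda>x. ereal \<bar>f x\<bar>" M]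
  proof eventually_elim
    case (elim x)
    then have "ereal \<bar>f x\<bar> \<le> ereal c" using c by (rule order_trans)
    then show ?case by simp
  qed
  then show "\<exists>c. AE x in M. \<bar>f x\<bar> \<le> c" by blast
next
  fix c assume [measurable]: "f \<in> borel_measurable M" and c: "AE x in M. \<bar>f x\<bar> \<le> c"
  have "esssup M (\<lambda>x. ereal \<bar>f x\<bar>) \<le> ereal c"
    by (rule esssup_I) (use c in auto)
  then show "f \<in> Linf M" by (auto simp: Linf_def Linf_norm_def)
qed

lemma (in prob_space) sigma_finite_subalgebraI:
  "subalgebra M B \<Longrightarrow> sigma_finite_subalgebra M B"
  by (intro finite_measure_subalgebra_is_sigma_finite finite_measure_subalgebra.intro
      finite_measure_axioms finite_measure_subalgebra_axioms.intro)

lemma (in prob_space) set_norm_le: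
  assumes "subalgebra M B" "AE x in M. \<bar>real_cond_exp M B (indicator A) x\<bar> \<le> c"
  shows "set_norm M B A \<le> ereal c"
proof -
  have [measurable]: "real_cond_exp M B (indicator A) \<in> borel_measurable M"
    by (rule measurable_from_subalg[OF assms(1)]) simp
  show ?thesis unfolding set_norm_def Linf_norm_def by (rule esssup_I) (use assms(2) in auto)
qed

text \<open>The essential supremum of the constant zero is zero because the total mass is not
  zero.\<close>

lemma (in prob_space) set_norm_nonneg: "0 \<le> set_norm M B A"
proof -
  have "esssup M (\<lambda>x. 0::ereal) \<le> esssup M (\<lambda>x. ereal \<bar>real_cond_exp M B (indicator A) x\<bar>)"
    by (rule esssup_mono) auto
  then show ?thesis
    unfolding set_norm_def Linf_norm_def by (simp add: esssup_const emeasure_space_1)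
qed

lemma (in prob_space) AE_abs_cond_exp_le_set_norm:
  "AE x in M. ereal \<bar>real_cond_exp M B (indicator A) x\<bar> \<le> set_norm M B A"
  unfolding set_norm_def Linf_norm_def by (rule esssup_AE)

lemma (in prob_space) ae_eq_set_iff_AE:
  assumes [measurable]: "A \<in> sets M" "B \<in> sets M"
  shows "ae_eq_set M A B \<longleftrightarrow> (AE x in M. x \<in> A \<longleftrightarrow> x \<in> B)"
proof -
  have "{x \<in> space M. \<not> (x \<in> A \<longleftrightarrow> x \<in> B)} = sym_diff A B"
    using sets.sets_into_space[OF assms(1)] sets.sets_into_space[OF assms(2)] by auto
  then show ?thesis unfolding ae_eq_set_def
    by (subst AE_iff_null) auto
qed

text \<open>The rates are uniform off small sets as in Egorov's theorem, and Borel--Cantelli removes the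
  exceptional sets.\<close>

lemma (in prob_space) AE_tendsto_zero_common_rate:
  fixes g :: "nat \<Rightarrow> 'a \<Rightarrow> real"
  assumes [measurable]: "\<And>n. g n \<in> borel_measurable M"
    and lim: "AE x in M. (\<lambda>n. g n x) \<longlonglongrightarrow> 0"
  shows "\<exists>e :: nat \<Rightarrow> real. (\<forall>n. 0 < e n) \<and> e \<longlonglongrightarrow> 0 \<and>
    (AE x in M. eventually (\<lambda>n. g n x \<le> e n) sequentially)"
proof -
  define D where "D m N = {x \<in> space M. \<exists>n\<in>{N..}. g n x > 1 / real (Suc m)}" for m N
  have [measurable]: "D m N \<in> sets M" for m N unfolding D_def by measurable
  have "\<exists>N. measure M (D m N) < (1/2)^m" for m
  proof -
    have "(\<lambda>N. measure M (D m N)) \<longlonglongrightarrow> measure M (\<Inter>N. D m N)"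
      by (rule finite_Lim_measure_decseq) (auto simp: decseq_def D_def)
    moreover have "measure M (\<Inter>N. D m N) = 0"
    proof -
      have "AE x in M. x \<notin> (\<Inter>N. D m N)"
        using lim
      proof eventually_elim
        case (elim x)
        then have "eventually (\<lambda>n. g n x < 1 / real (Suc m)) sequentially"
          by (rule order_tendstoD) simp
        then obtain N where "\<And>n. n \<ge> N \<Longrightarrow> g n x < 1 / real (Suc m)"
          by (auto simp: eventually_sequentially)
        then have "x \<notin> D m N" unfolding D_def by force
        then show ?case by auto
      qed
      then show ?thesis
        by (subst prob_eq_0) auto
    qed
    ultimately have "eventually (\<lambda>N. measure M (D m N) < (1/2)^m) sequentially"
      by (auto intro: order_tendstoD)
    then show ?thesis by (auto simp: eventually_sequentially)
  qed
  then obtain N where N: "\<And>m. measure M (D m (N m)) < (1/2)^m" by metis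
  have "summable (\<lambda>m. measure M (D m (N m)))"
    by (rule summable_comparison_test'[of "\<lambda>m. (1/2)^m" 0])
       (use N in \<open>auto intro: less_imp_le\<close>)
  then have bc: "AE x in M. eventually (\<lambda>m. x \<in> space M - D m (N m)) sequentially"
    by (intro borel_cantelli_AE1) (auto simp: emeasure_eq_measure)
  \<comment> \<open>\<open>1 / Suc (r n)\<close> will be the rate: \<open>r n\<close> is the largest
    level \<open>m\<close> whose threshold \<open>N m\<close> has been passed by time
    \<open>n\<close>. The bound \<open>m \<le> n\<close> keeps the set finite without monotonicity
    of \<open>N\<close>, and \<open>0\<close> is a default that keeps it nonempty.\<close>
  define r where "r n = Max (insert 0 {m. m \<le> n \<and> N m \<le> n})" for n
  have fin: "finite (insert 0 {m. m \<le> n \<and> N m \<le> n})" for n by auto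
  have r_ge: "eventually (\<lambda>n. k \<le> r n) sequentially" for k
    unfolding eventually_sequentially
  proof (intro exI allI impI)
    fix n assume "max k (N k) \<le> n"
    then show "k \<le> r n" unfolding r_def by (intro Max_ge[OF fin]) auto
  qed
  then have "filterlim r at_top sequentially"
    by (simp add: filterlim_at_top)
  then have "(\<lambda>n. inverse (real (Suc (r n)))) \<longlonglongrightarrow> 0"
    by (rule filterlim_compose[OF LIMSEQ_inverse_real_of_nat])
  moreover have "AE x in M. eventually (\<lambda>n. g n x \<le> inverse (real (Suc (r n)))) sequentially"
    using bc
  proof eventually_elim
    case (elim x)
    then obtain m0 where m0: "\<And>m. m \<ge> m0 \<Longrightarrow> x \<in> space M - D m (N m)"
      by (auto simp: eventually_sequentially)
    \<comment> \<open>From \<open>1 \<le> r n\<close> it follows that \<open>r n\<close> is not the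
      default \<open>0\<close>, so \<open>N (r n) \<le> n\<close> really holds;
      \<open>m0 \<le> r n\<close> puts \<open>x\<close> outside the exceptional set of that
      level.\<close>
    show ?case using r_ge[of "max 1 m0"]
    proof eventually_elim
      case (elim n)
      have "r n \<in> insert 0 {m. m \<le> n \<and> N m \<le> n}"
        unfolding r_def by (rule Max_in[OF fin]) auto
      then have "N (r n) \<le> n" using elim by auto
      moreover have "x \<in> space M - D (r n) (N (r n))" using elim by (intro m0) auto
      ultimately show ?case unfolding D_def by (auto simp: not_less inverse_eq_divide)
    qed
  qed
  ultimately show ?thesis
    by (intro exI[of _ "\<lambda>n. inverse (real (Suc (r n)))"]) auto
qed

section \<open>The algebra of essentially bounded functions\<close>

locale ae_convergent_subalgebras = prob_space M for M :: "'a measure" +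
  fixes F :: "nat \<Rightarrow> 'a measure"
  assumes subalg: "\<And>n. subalgebra M (F n)"
    and convergent_cond_exp:
      "\<And>f. f \<in> Linf M \<Longrightarrow> AE x in M. convergent (\<lambda>n. real_cond_exp M (F n) f x)"
begin

abbreviation E :: "nat \<Rightarrow> ('a \<Rightarrow> real) \<Rightarrow> 'a \<Rightarrow> real" where
  "E n \<equiv> real_cond_exp M (F n)"

text \<open>For \<open>f\<close> in \<open>Linf M\<close> the points of divergence form a null set.
  There \<open>lim\<close> takes one fixed value, so \<open>T f\<close> is measurable
  everywhere.\<close>

definition T :: "('a \<Rightarrow> real) \<Rightarrow> 'a \<Rightarrow> real" where
  "T f x = lim (\<lambda>n. E n f x)"

lemmas sfs = sigma_finite_subalgebraI[OF subalg]

lemma Linf_measurable [measurable_dest]: "f \<in> Linf M \<Longrightarrow> f \<in> borel_measurable M"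
  by (simp add: Linf_iff_AE_bounded)

lemma E_measurable [measurable]: "E n f \<in> borel_measurable M"
  by (rule measurable_from_subalg[OF subalg borel_measurable_cond_exp])

lemma T_measurable [measurable]: "T f \<in> borel_measurable M"
  unfolding T_def by measurable

lemma Linf_boundedE:
  assumes "f \<in> Linf M"
  obtains c where "0 \<le> c" "AE x in M. \<bar>f x\<bar> \<le> c"
proof -
  obtain c where "AE x in M. \<bar>f x\<bar> \<le> c" using assms by (auto simp: Linf_iff_AE_bounded)
  then have "AE x in M. \<bar>f x\<bar> \<le> max 0 c" by eventually_elim auto
  then show thesis by (rule that[rotated]) simp
qed

lemma LinfI: "f \<in> borel_measurable M \<Longrightarrow> AE x in M. \<bar>f x\<bar> \<le> c \<Longrightarrow> f \<in> Linf M"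
  by (auto simp: Linf_iff_AE_bounded)

lemma Linf_integrable [simp, intro]:
  assumes "f \<in> Linf M" shows "integrable M f"
proof -
  obtain c where "AE x in M. \<bar>f x\<bar> \<le> c" using assms by (rule Linf_boundedE)
  then show ?thesis
    by (intro integrable_const_bound[of _ c]) (use assms in \<open>auto simp: Linf_measurable\<close>)
qed

lemma Linf_const [simp, intro]: "(\<lambda>x. c) \<in> Linf M"
  by (rule LinfI[of _ "\<bar>c\<bar>"]) auto

lemma Linf_indicator [simp, intro]: "A \<in> sets M \<Longrightarrow> indicator A \<in> Linf M"
  by (rule LinfI[of _ 1]) (auto simp: indicator_def)

lemma Linf_mult [intro]:
  assumes "f \<in> Linf M" "g \<in> Linf M" shows "(\<lambda>x. f x * g x) \<in> Linf M"
proof -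
  obtain c where c: "0 \<le> c" "AE x in M. \<bar>f x\<bar> \<le> c" using assms(1) by (rule Linf_boundedE)
  obtain d where "AE x in M. \<bar>g x\<bar> \<le> d" using assms(2) by (rule Linf_boundedE)
  with c(2) have "AE x in M. \<bar>f x * g x\<bar> \<le> c * d"
  proof eventually_elim
    case (elim x)
    then show ?case using c(1) by (simp add: abs_mult mult_mono)
  qed
  then show ?thesis by (rule LinfI[rotated]) (use assms in \<open>auto simp: Linf_measurable\<close>)
qed

lemma Linf_diff [intro]:
  assumes "f \<in> Linf M" "g \<in> Linf M" shows "(\<lambda>x. f x - g x) \<in> Linf M"
proof -
  obtain c where "AE x in M. \<bar>f x\<bar> \<le> c" using assms(1) by (rule Linf_boundedE)
  moreover obtain d where "AE x in M. \<bar>g x\<bar> \<le> d" using assms(2) by (rule Linf_boundedE)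
  ultimately have "AE x in M. \<bar>f x - g x\<bar> \<le> c + d" by eventually_elim auto
  then show ?thesis by (rule LinfI[rotated]) (use assms in \<open>auto simp: Linf_measurable\<close>)
qed

lemma Linf_abs [intro]: "f \<in> Linf M \<Longrightarrow> (\<lambda>x. \<bar>f x\<bar>) \<in> Linf M"
  by (auto simp: Linf_iff_AE_bounded)

lemma cond_exp_abs_le:
  assumes "subalgebra M B" "f \<in> Linf M" "AE x in M. \<bar>f x\<bar> \<le> c"
  shows "AE x in M. \<bar>real_cond_exp M B f x\<bar> \<le> c"
proof -
  note s = sigma_finite_subalgebraI[OF assms(1)]
  have "AE x in M. f x \<le> c" "AE x in M. -c \<le> f x"
    using assms(3) by (eventually_elim, simp)+
  then have "AE x in M. real_cond_exp M B f x \<le> c" "AE x in M. -c \<le> real_cond_exp M B f x"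
    using sigma_finite_subalgebra.real_cond_exp_le_c[OF s Linf_integrable[OF assms(2)]]
      sigma_finite_subalgebra.real_cond_exp_ge_c[OF s Linf_integrable[OF assms(2)]] by blast+
  then show ?thesis by eventually_elim auto
qed

lemma cond_exp_Linf [intro]:
  assumes "subalgebra M B" "f \<in> Linf M" shows "real_cond_exp M B f \<in> Linf M"
proof -
  obtain c where "AE x in M. \<bar>f x\<bar> \<le> c" using assms(2) by (rule Linf_boundedE)
  from cond_exp_abs_le[OF assms this] show ?thesis
    by (rule LinfI[rotated]) (auto intro: measurable_from_subalg[OF assms(1)])
qed

lemma E_Linf [intro]: "f \<in> Linf M \<Longrightarrow> E n f \<in> Linf M"
  using subalg by auto

section \<open>The limit operator as a positive self-adjoint projection\<close>

lemma E_tendsto_T: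
  assumes "f \<in> Linf M" shows "AE x in M. (\<lambda>n. E n f x) \<longlonglongrightarrow> T f x"
  using convergent_cond_exp[OF assms]
  by eventually_elim (simp add: T_def convergent_LIMSEQ_iff)

text \<open>A single null set serves all \<open>n\<close>, so the bound passes to the pointwise
  limit and gives a dominating constant.\<close>

lemma AE_all_E_abs_le:
  assumes "f \<in> Linf M" "AE x in M. \<bar>f x\<bar> \<le> c"
  shows "AE x in M. \<forall>n. \<bar>E n f x\<bar> \<le> c"
  using cond_exp_abs_le[OF subalg assms] by (simp add: AE_all_countable)

lemma T_Linf [intro]:
  assumes "f \<in> Linf M" shows "T f \<in> Linf M"
proof -
  obtain c where c: "AE x in M. \<bar>f x\<bar> \<le> c" using assms by (rule Linf_boundedE)
  have "AE x in M. \<bar>T f x\<bar> \<le> c"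
    using AE_all_E_abs_le[OF assms c] E_tendsto_T[OF assms]
  proof eventually_elim
    case (elim x)
    then show ?case by (intro LIMSEQ_le_const2[OF tendsto_rabs]) auto
  qed
  then show ?thesis by (rule LinfI[rotated]) simp
qed

text \<open>This weak convergence is how identities for pairings with \<open>E n\<close> are carried
  over to \<open>T\<close>.\<close>

lemma integral_E_mult_tendsto:
  assumes f: "f \<in> Linf M" and g: "g \<in> Linf M"
  shows "(\<lambda>n. \<integral>x. E n f x * g x \<partial>M) \<longlonglongrightarrow> (\<integral>x. T f x * g x \<partial>M)"
proof -
  obtain c where c: "AE x in M. \<bar>f x\<bar> \<le> c" using f by (rule Linf_boundedE)
  show ?thesis
  proof (rule integral_dominated_convergence[where w = "\<lambda>x. c * \<bar>g x\<bar>"])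
    show "AE x in M. (\<lambda>n. E n f x * g x) \<longlonglongrightarrow> T f x * g x"
      using E_tendsto_T[OF f] by eventually_elim (intro tendsto_intros)
    show "AE x in M. norm (E n f x * g x) \<le> c * \<bar>g x\<bar>" for n
      using AE_all_E_abs_le[OF f c] by eventually_elim (auto simp: abs_mult intro!: mult_right_mono)
  qed (use g in \<open>auto simp: Linf_measurable\<close>)
qed

text \<open>Both sides equal the pairing of the two conditional expectations, which is symmetric in
  \<open>f\<close> and \<open>g\<close>.\<close>

lemma cond_exp_self_adjoint:
  assumes "subalgebra M B" "f \<in> Linf M" "g \<in> Linf M"
  shows "(\<integral>x. real_cond_exp M B f x * g x \<partial>M) = (\<integral>x. f x * real_cond_exp M B g x \<partial>M)"
proof -
  note s = sigma_finite_subalgebraI[OF assms(1)]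
  note I = sigma_finite_subalgebra.real_cond_exp_intg(2)[OF s]
  have [measurable]: "f \<in> borel_measurable M" "g \<in> borel_measurable M" using assms by auto
  have "(\<integral>x. real_cond_exp M B f x * g x \<partial>M) = (\<integral>x. real_cond_exp M B f x * real_cond_exp M B g x \<partial>M)"
    using assms by (intro I[symmetric]) auto
  also have "\<dots> = (\<integral>x. real_cond_exp M B g x * f x \<partial>M)"
    using assms by (subst I[symmetric]) (auto simp: mult.commute)
  finally show ?thesis by (simp add: mult.commute)
qed

lemma T_self_adjoint:
  assumes f: "f \<in> Linf M" and g: "g \<in> Linf M"
  shows "(\<integral>x. T f x * g x \<partial>M) = (\<integral>x. f x * T g x \<partial>M)"
proof -
  have "(\<integral>x. E n f x * g x \<partial>M) = (\<integral>x. E n g x * f x \<partial>M)" for n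
    unfolding cond_exp_self_adjoint[OF subalg f g] by (simp only: mult.commute)
  then have "(\<lambda>n. \<integral>x. E n f x * g x \<partial>M) \<longlonglongrightarrow> (\<integral>x. T g x * f x \<partial>M)"
    using integral_E_mult_tendsto[OF g f] by simp
  from LIMSEQ_unique[OF integral_E_mult_tendsto[OF f g] this] show ?thesis
    by (simp add: mult.commute)
qed

lemma T_mono:
  assumes "f \<in> Linf M" "g \<in> Linf M" "AE x in M. f x \<le> g x"
  shows "AE x in M. T f x \<le> T g x"
proof -
  have "AE x in M. \<forall>n. E n f x \<le> E n g x"
    using sigma_finite_subalgebra.real_cond_exp_mono[OF sfs assms(3)] assms
    by (simp add: AE_all_countable Linf_integrable)
  with E_tendsto_T[OF assms(1)] E_tendsto_T[OF assms(2)] show ?thesis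
    by eventually_elim (blast intro: LIMSEQ_le)
qed

lemma T_cong:
  assumes "f \<in> Linf M" "g \<in> Linf M" "AE x in M. f x = g x"
  shows "AE x in M. T f x = T g x"
proof -
  have "AE x in M. f x \<le> g x" "AE x in M. g x \<le> f x"
    using assms(3) by (eventually_elim, simp)+
  from T_mono[OF assms(1,2) this(1)] T_mono[OF assms(2,1) this(2)] show ?thesis
    by eventually_elim simp
qed

lemma T_diff:
  assumes "f \<in> Linf M" "g \<in> Linf M"
  shows "AE x in M. T (\<lambda>x. f x - g x) x = T f x - T g x"
proof -
  have "AE x in M. \<forall>n. E n (\<lambda>x. f x - g x) x = E n f x - E n g x"
    using sigma_finite_subalgebra.real_cond_exp_diff[OF sfs] assms
    by (simp add: AE_all_countable Linf_integrable)
  from E_tendsto_T[OF assms(1)] E_tendsto_T[OF assms(2)] this E_tendsto_T[OF Linf_diff[OF assms]]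
  show ?thesis
  proof eventually_elim
    case (elim x)
    from elim(4) tendsto_diff[OF elim(1,2)] show ?case
      unfolding elim(3)[rule_format] by (rule LIMSEQ_unique)
  qed
qed

lemma T_const: "AE x in M. T (\<lambda>x. c) x = c"
proof -
  have "AE x in M. \<forall>n. E n (\<lambda>x. c) x = c"
    using sigma_finite_subalgebra.real_cond_exp_F_meas[OF sfs]
    by (simp add: AE_all_countable)
  then show ?thesis by eventually_elim (simp add: T_def)
qed

lemma T_cmult:
  assumes "f \<in> Linf M"
  shows "AE x in M. T (\<lambda>x. c * f x) x = c * T f x"
proof -
  have "AE x in M. \<forall>n. E n (\<lambda>x. c * f x) x = c * E n f x"
    using sigma_finite_subalgebra.real_cond_exp_cmult[OF sfs] assms
    by (simp add: AE_all_countable Linf_integrable)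
  from E_tendsto_T[OF assms] this E_tendsto_T[OF Linf_mult[OF Linf_const assms], of c]
  show ?thesis
  proof eventually_elim
    case (elim x)
    from elim(3) tendsto_mult_left[OF elim(1)] show ?case
      unfolding elim(2)[rule_format] by (rule LIMSEQ_unique)
  qed
qed

text \<open>This is self-adjointness tested against the constant 1, a fixed point of
  \<open>T\<close>.\<close>

lemma integral_T:
  assumes "f \<in> Linf M" shows "(\<integral>x. T f x \<partial>M) = (\<integral>x. f x \<partial>M)"
proof -
  have "(\<integral>x. T f x \<partial>M) = (\<integral>x. f x * T (\<lambda>x. 1) x \<partial>M)"
    using T_self_adjoint[OF assms, of "\<lambda>x. 1"] by simp
  also have "\<dots> = (\<integral>x. f x \<partial>M)"
    using T_const[of 1] by (intro integral_cong_AE) (use assms in \<open>auto simp: Linf_measurable\<close>)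
  finally show ?thesis .
qed

text \<open>Idempotence of \<open>E n\<close> passes to the limit because \<open>\<langle>E n f, E n g\<rangle> = \<langle>E n f, g\<rangle>\<close> and the
  left-hand side converges to \<open>\<langle>T f, T g\<rangle>\<close> by dominated convergence.\<close>

lemma integral_T_mult_T:
  assumes f: "f \<in> Linf M" and g: "g \<in> Linf M"
  shows "(\<integral>x. T f x * T g x \<partial>M) = (\<integral>x. T f x * g x \<partial>M)"
proof -
  obtain c where c: "0 \<le> c" "AE x in M. \<bar>f x\<bar> \<le> c" using f by (rule Linf_boundedE)
  obtain d where d: "AE x in M. \<bar>g x\<bar> \<le> d" using g by (rule Linf_boundedE)
  have "(\<lambda>n. \<integral>x. E n f x * E n g x \<partial>M) \<longlonglongrightarrow> (\<integral>x. T f x * T g x \<partial>M)"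
  proof (rule integral_dominated_convergence[where w = "\<lambda>x. c * d"])
    show "AE x in M. (\<lambda>n. E n f x * E n g x) \<longlonglongrightarrow> T f x * T g x"
      using E_tendsto_T[OF f] E_tendsto_T[OF g] by eventually_elim (intro tendsto_intros)
    show "AE x in M. norm (E n f x * E n g x) \<le> c * d" for n
      using AE_all_E_abs_le[OF f c(2)] AE_all_E_abs_le[OF g d]
      by eventually_elim (use c(1) in \<open>simp add: abs_mult mult_mono\<close>)
  qed auto
  moreover have "(\<integral>x. E n f x * E n g x \<partial>M) = (\<integral>x. E n f x * g x \<partial>M)" for n
  proof -
    have "AE x in M. E n (E n f) x = E n f x"
      using E_Linf[OF f] by (auto intro: sigma_finite_subalgebra.real_cond_exp_F_meas[OF sfs])
    then have "(\<integral>x. E n (E n f) x * g x \<partial>M) = (\<integral>x. E n f x * g x \<partial>M)"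
      by (intro integral_cong_AE) (use g in \<open>auto simp: Linf_measurable\<close>)
    then show ?thesis
      unfolding cond_exp_self_adjoint[OF subalg E_Linf[OF f] g] .
  qed
  ultimately show ?thesis
    using integral_E_mult_tendsto[OF f g] by (auto intro: LIMSEQ_unique)
qed

text \<open>The defect \<open>k = T (T f) - T f\<close> is orthogonal to itself: the pairing of
  \<open>T (T f)\<close> with \<open>k\<close> is that of \<open>T f\<close> with
  \<open>T k\<close>, hence that of \<open>T f\<close> with \<open>k\<close>.\<close>

lemma T_idem:
  assumes f: "f \<in> Linf M" shows "AE x in M. T (T f) x = T f x"
proof -
  define k where "k = (\<lambda>x. T (T f) x - T f x)"
  have k: "k \<in> Linf M" unfolding k_def by (intro Linf_diff T_Linf f)
  have "(\<integral>x. k x * k x \<partial>M) = (\<integral>x. T (T f) x * k x - T f x * k x \<partial>M)"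
    by (simp add: k_def left_diff_distrib)
  also have "\<dots> = (\<integral>x. T (T f) x * k x \<partial>M) - (\<integral>x. T f x * k x \<partial>M)"
    by (intro Bochner_Integration.integral_diff Linf_integrable Linf_mult T_Linf f k)
  also have "\<dots> = 0"
    using T_self_adjoint[OF T_Linf[OF f] k] integral_T_mult_T[OF f k] by simp
  finally have "AE x in M. k x * k x = 0"
    by (subst (asm) integral_nonneg_eq_0_iff_AE) (use k in auto)
  then show ?thesis by eventually_elim (simp add: k_def)
qed

text \<open>A nonnegative function with integral zero vanishes a.e. Since \<open>T\<close> preserves
  integrals, an inequality between \<open>T f\<close> and \<open>f\<close> in either direction thus
  makes \<open>f\<close> a fixed point.\<close>

lemma AE_eq_if_le_and_integral_eq:
  assumes "f \<in> Linf M" "g \<in> Linf M" "AE x in M. f x \<le> g x"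
    "(\<integral>x. f x \<partial>M) = (\<integral>x. g x \<partial>M)"
  shows "AE x in M. f x = g x"
proof -
  have "(\<integral>x. g x - f x \<partial>M) = 0" using assms by simp
  then have "AE x in M. g x - f x = 0"
    by (subst (asm) integral_nonneg_eq_0_iff_AE) (use assms in auto)
  then show ?thesis by eventually_elim simp
qed

lemma T_fixed_if_le:
  assumes "f \<in> Linf M" "AE x in M. T f x \<le> f x"
  shows "AE x in M. T f x = f x"
  using assms by (intro AE_eq_if_le_and_integral_eq) (auto simp: integral_T)

lemma T_fixed_if_ge:
  assumes "f \<in> Linf M" "AE x in M. f x \<le> T f x"
  shows "AE x in M. T f x = f x"
  using AE_eq_if_le_and_integral_eq[OF assms(1) T_Linf[OF assms(1)] assms(2)] assms
  by (auto simp: integral_T)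

section \<open>Uniform covers and fixed indicators\<close>

text \<open>As \<open>a n\<close> is measurable for \<open>F n\<close>,
  \<open>E n (indicator A)\<close> is at most
  \<open>indicator (a n) + E n (indicator (A - a n))\<close>. Almost every point off
  \<open>A\<close> lies in only finitely many \<open>a n\<close>, and the second term is bounded by
  a norm tending to zero, so the limit is at most zero there.\<close>

lemma uniformly_covered_imp_T_fixed:
  assumes [measurable]: "A \<in> sets M" and u: "uniformly_covered M F A"
  shows "AE x in M. T (indicator A) x = indicator A x"
proof (rule T_fixed_if_le)
  show "indicator A \<in> Linf M" by simp
  obtain a where a: "\<And>n. a n \<in> sets (F n)"
    and a2: "ae_eq_set M A (\<Inter>N. \<Union>n\<in>{N..}. a n)"
    and a3: "(\<lambda>n. set_norm M (F n) (A - a n)) \<longlonglongrightarrow> 0"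
    using u unfolding uniformly_covered_def by blast
  have [measurable]: "a n \<in> sets M" for n using a subalg[of n] unfolding subalgebra_def by auto
  have A: "AE x in M. x \<in> A \<longleftrightarrow> x \<in> (\<Inter>N. \<Union>n\<in>{N..}. a n)"
    using a2 by (subst (asm) ae_eq_set_iff_AE) auto
  have le: "AE x in M. \<forall>n. E n (indicator A) x \<le> indicator (a n) x + E n (indicator (A - a n)) x"
    unfolding AE_all_countable
  proof
    fix n
    note s = sfs[of n]
    have "AE x in M. E n (indicator A) x \<le> E n (\<lambda>x. indicator (a n) x + indicator (A - a n) x) x"
    proof (rule sigma_finite_subalgebra.real_cond_exp_mono[OF s])
      show "AE x in M. indicator A x \<le> (indicator (a n) x + indicator (A - a n) x :: real)"
        by (auto simp: indicator_def)
    qed auto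
    moreover have "AE x in M. E n (\<lambda>x. indicator (a n) x + indicator (A - a n) x) x
        = E n (indicator (a n)) x + E n (indicator (A - a n)) x"
      by (rule sigma_finite_subalgebra.real_cond_exp_add[OF s]) auto
    moreover have "AE x in M. E n (indicator (a n)) x = indicator (a n) x"
      by (rule sigma_finite_subalgebra.real_cond_exp_F_meas[OF s]) (use a in auto)
    ultimately show "AE x in M. E n (indicator A) x \<le> indicator (a n) x + E n (indicator (A - a n)) x"
      by eventually_elim auto
  qed
  have nrm: "AE x in M. \<forall>n. ereal \<bar>E n (indicator (A - a n)) x\<bar> \<le> set_norm M (F n) (A - a n)"
    unfolding AE_all_countable using AE_abs_cond_exp_le_set_norm by blast
  \<comment> \<open>On \<open>A\<close> itself the required inequality is only
    \<open>T (indicator A) x \<le> 1\<close>, which follows from positivity.\<close>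
  have "AE x in M. T (indicator A) x \<le> T (\<lambda>x. 1) x"
    by (rule T_mono) (auto simp: indicator_def)
  then have one: "AE x in M. T (indicator A) x \<le> 1"
    using T_const[of 1] by eventually_elim simp
  show "AE x in M. T (indicator A) x \<le> indicator A x"
    using A le nrm one E_tendsto_T[OF Linf_indicator[OF assms(1)]]
  proof eventually_elim
    case (elim x)
    show ?case
    proof (cases "x \<in> A")
      case True then show ?thesis using elim by simp
    next
      case False
      then obtain N where N: "\<And>n. n \<ge> N \<Longrightarrow> x \<notin> a n" using elim(1) by auto
      have "(\<lambda>n. ereal \<bar>E n (indicator (A - a n)) x\<bar>) \<longlonglongrightarrow> 0"
        by (rule tendsto_sandwich[OF _ _ tendsto_const a3]) (use elim in auto)
      then have "(\<lambda>n. \<bar>E n (indicator (A - a n)) x\<bar>) \<longlonglongrightarrow> 0"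
        by (simp add: zero_ereal_def)
      then have "(\<lambda>n. E n (indicator (A - a n)) x) \<longlonglongrightarrow> 0"
        by (simp add: tendsto_rabs_zero_iff)
      then have "T (indicator A) x \<le> 0"
      proof (rule LIMSEQ_le[OF elim(5)])
        show "\<exists>N. \<forall>n\<ge>N. E n (indicator A) x \<le> E n (indicator (A - a n)) x"
        proof (intro exI allI impI)
          fix n assume "N \<le> n"
          then show "E n (indicator A) x \<le> E n (indicator (A - a n)) x"
            using N elim(2)[rule_format, of n] by simp
        qed
      qed
      then show ?thesis using False by simp
    qed
  qed
qed

text \<open>On \<open>A\<close> the functions \<open>E n (indicator A)\<close> tend to 1 and
  eventually exceed \<open>e n\<close>; off \<open>A\<close> they eventually stay below it, by the
  choice of \<open>e\<close>. So almost every point eventually lies in \<open>a n\<close> exactly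
  when it lies in \<open>A\<close>, which gives both limit conditions.\<close>

lemma T_fixed_imp_uniformly_covered:
  assumes [measurable]: "A \<in> sets M" and fixed: "AE x in M. T (indicator A) x = indicator A x"
  shows "uniformly_covered M F A"
proof -
  have lim: "AE x in M. (\<lambda>n. E n (indicator A) x) \<longlonglongrightarrow> indicator A x"
    using E_tendsto_T[OF Linf_indicator[OF assms(1)]] fixed by eventually_elim simp
  \<comment> \<open>Cutting off to the complement of \<open>A\<close> leaves a sequence with limit
    zero a.e., as the choice of a common rate requires.\<close>
  define g where "g n x = E n (indicator A) x * indicator (space M - A) x" for n x
  have "AE x in M. (\<lambda>n. g n x) \<longlonglongrightarrow> 0"
    using lim by eventually_elim (auto simp: g_def indicator_def)
  moreover have "g n \<in> borel_measurable M" for n unfolding g_def by measurable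
  ultimately obtain e :: "nat \<Rightarrow> real" where e: "\<And>n. 0 < e n" "e \<longlonglongrightarrow> 0"
    and eg: "AE x in M. eventually (\<lambda>n. g n x \<le> e n) sequentially"
    using AE_tendsto_zero_common_rate[of g] by blast
  define a where "a n = {x \<in> space M. E n (indicator A) x > e n}" for n
  have aF: "a n \<in> sets (F n)" for n
  proof -
    have "{x \<in> space (F n). E n (indicator A) x > e n} \<in> sets (F n)" by measurable
    moreover have "space (F n) = space M" using subalg[of n] by (simp add: subalgebra_def)
    ultimately show ?thesis unfolding a_def by metis
  qed
  have [measurable]: "a n \<in> sets M" for n using aF subalg[of n] unfolding subalgebra_def by auto
  have ev: "AE x in M. eventually (\<lambda>n. x \<in> a n \<longleftrightarrow> x \<in> A) sequentially"
    using lim eg AE_space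
  proof eventually_elim
    case (elim x)
    show ?case
    proof (cases "x \<in> A")
      case True
      then have "(\<lambda>n. E n (indicator A) x - e n) \<longlonglongrightarrow> 1 - 0"
        using elim(1) by (intro tendsto_diff e) simp
      then have "eventually (\<lambda>n. 0 < E n (indicator A) x - e n) sequentially"
        by (rule order_tendstoD) simp
      then show ?thesis by eventually_elim (use True elim in \<open>auto simp: a_def\<close>)
    next
      case False
      from elim(2) show ?thesis
        by eventually_elim (use False elim(3) in \<open>auto simp: a_def g_def\<close>)
    qed
  qed
  have "AE x in M. x \<in> A \<longleftrightarrow> x \<in> (\<Union>N. \<Inter>n\<in>{N..}. a n)"
    using ev
  proof eventually_elim
    case (elim x)
    then obtain N where N: "\<And>n. n \<ge> N \<Longrightarrow> x \<in> a n \<longleftrightarrow> x \<in> A"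
      by (auto simp: eventually_sequentially)
    show ?case
    proof
      assume "x \<in> A"
      then show "x \<in> (\<Union>N. \<Inter>n\<in>{N..}. a n)" using N by (intro UN_I[of N]) auto
    next
      assume "x \<in> (\<Union>N. \<Inter>n\<in>{N..}. a n)"
      then obtain N' where "\<And>n. n \<ge> N' \<Longrightarrow> x \<in> a n" by auto
      then show "x \<in> A" using N[of "max N N'"] by simp
    qed
  qed
  then have 1: "ae_eq_set M A (\<Union>N. \<Inter>n\<in>{N..}. a n)"
    by (subst ae_eq_set_iff_AE) auto
  have "AE x in M. x \<in> A \<longleftrightarrow> x \<in> (\<Inter>N. \<Union>n\<in>{N..}. a n)"
    using ev
  proof eventually_elim
    case (elim x)
    then obtain N where N: "\<And>n. n \<ge> N \<Longrightarrow> x \<in> a n \<longleftrightarrow> x \<in> A"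
      by (auto simp: eventually_sequentially)
    show ?case
    proof
      assume "x \<in> A"
      then have "x \<in> a (max N N')" for N' using N by simp
      then show "x \<in> (\<Inter>N. \<Union>n\<in>{N..}. a n)" by (metis INT_I UN_I atLeast_iff max.cobounded2)
    next
      assume "x \<in> (\<Inter>N. \<Union>n\<in>{N..}. a n)"
      then obtain n where "n \<ge> N" "x \<in> a n" by auto
      then show "x \<in> A" using N by simp
    qed
  qed
  then have 2: "ae_eq_set M A (\<Inter>N. \<Union>n\<in>{N..}. a n)"
    by (subst ae_eq_set_iff_AE) auto
  have le: "set_norm M (F n) (A - a n) \<le> ereal (e n)" for n
  proof (rule set_norm_le[OF subalg])
    note s = sfs[of n]
    have sp: "space (F n) = space M" using subalg[of n] by (simp add: subalgebra_def)
    have [measurable]: "space M - a n \<in> sets (F n)"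
      using sets.compl_sets[OF aF[of n]] sp by simp
    \<comment> \<open>The complement of \<open>a n\<close> belongs to \<open>F n\<close>, so its
      indicator can be pulled out; on it \<open>E n (indicator A)\<close> is at most
      \<open>e n\<close> by definition of \<open>a n\<close>.\<close>
    have "AE x in M. E n (\<lambda>x. indicator (space M - a n) x * indicator A x) x
        = indicator (space M - a n) x * E n (indicator A) x"
      by (rule sigma_finite_subalgebra.real_cond_exp_mult[OF s])
        (auto intro!: Linf_integrable Linf_mult)
    moreover have "AE x in M. E n (indicator (A - a n)) x
        = E n (\<lambda>x. indicator (space M - a n) x * indicator A x) x"
      by (rule sigma_finite_subalgebra.real_cond_exp_cong[OF s]) (auto simp: indicator_def)
    moreover have "AE x in M. 0 \<le> E n (indicator A) x"
      by (rule sigma_finite_subalgebra.real_cond_exp_pos[OF s]) auto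
    ultimately show "AE x in M. \<bar>E n (indicator (A - a n)) x\<bar> \<le> e n"
      using AE_space
      by eventually_elim (use e(1)[of n] in \<open>auto simp: a_def indicator_def\<close>)
  qed
  have "(\<lambda>n. ereal (e n)) \<longlonglongrightarrow> 0" using e(2) by (simp add: zero_ereal_def)
  then have "(\<lambda>n. set_norm M (F n) (A - a n)) \<longlonglongrightarrow> 0"
    by (rule tendsto_sandwich[OF _ _ tendsto_const, rotated 2]) (auto simp: set_norm_nonneg le)
  with 1 2 aF show ?thesis unfolding uniformly_covered_def by blast
qed

lemma T_fixed_Compl:
  assumes [measurable]: "A \<in> sets M" and fixed: "AE x in M. T (indicator A) x = indicator A x"
  shows "AE x in M. T (indicator (space M - A)) x = indicator (space M - A) x"
proof -
  have "AE x in M. T (indicator (space M - A)) x = T (\<lambda>x. 1 - indicator A x) x"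
  proof (rule T_cong)
    show "AE x in M. indicator (space M - A) x = (1 - indicator A x :: real)"
      using AE_space by eventually_elim (auto simp: indicator_def)
  qed (auto intro!: Linf_diff)
  moreover have "AE x in M. T (\<lambda>x. 1 - indicator A x) x = T (\<lambda>x. 1) x - T (indicator A) x"
    by (rule T_diff) auto
  ultimately show ?thesis using fixed T_const[of 1] AE_space
    by eventually_elim (auto simp: indicator_def)
qed

text \<open>Fixed indicators are stable under complements, so a fixed \<open>A\<close> yields
  uniform covers of both \<open>A\<close> and its complement.\<close>

lemma A_mu_ae_iff_T_fixed:
  "A \<in> A_mu_ae M F \<longleftrightarrow> A \<in> sets M \<and> (AE x in M. T (indicator A) x = indicator A x)"
  unfolding A_mu_ae_def
  by (auto intro: uniformly_covered_imp_T_fixed T_fixed_imp_uniformly_covered T_fixed_Compl)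

section \<open>Closure properties of the fixed sets\<close>

text \<open>By positivity the image of the indicator of the union dominates the indicator of every
  \<open>A i\<close>, hence that of the union. No continuity of \<open>T\<close> along the union
  enters.\<close>

lemma T_fixed_UN:
  fixes A :: "nat \<Rightarrow> 'a set"
  assumes [measurable]: "\<And>i. A i \<in> sets M"
    and fixed: "\<And>i. AE x in M. T (indicator (A i)) x = indicator (A i) x"
  shows "AE x in M. T (indicator (\<Union>i. A i)) x = indicator (\<Union>i. A i) x"
proof (rule T_fixed_if_ge)
  have "AE x in M. \<forall>i. T (indicator (A i)) x \<le> T (indicator (\<Union>i. A i)) x"
    unfolding AE_all_countable by (intro allI T_mono) (auto simp: indicator_def)
  moreover have "AE x in M. \<forall>i. T (indicator (A i)) x = indicator (A i) x"
    unfolding AE_all_countable using fixed by blast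
  moreover have "AE x in M. T (\<lambda>x. 0) x \<le> T (indicator (\<Union>i. A i)) x"
    by (rule T_mono) auto
  ultimately show "AE x in M. indicator (\<Union>i. A i) x \<le> T (indicator (\<Union>i. A i)) x"
    using T_const[of 0]
  proof eventually_elim
    case (elim x)
    show ?case
    proof (cases "x \<in> (\<Union>i. A i)")
      case True
      then obtain i where "x \<in> A i" by auto
      then show ?thesis using elim(1,2)[rule_format, of i] True by simp
    next
      case False then show ?thesis using elim by simp
    qed
  qed
qed auto

lemma sigma_algebra_A_mu_ae: "sigma_algebra (space M) (A_mu_ae M F)"
  unfolding sigma_algebra_iff2
proof (intro conjI ballI allI impI)
  show "A_mu_ae M F \<subseteq> Pow (space M)"
    using sets.sets_into_space by (auto simp: A_mu_ae_def)
  show "{} \<in> A_mu_ae M F"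
  proof -
    have "indicator {} = (\<lambda>x::'a. 0::real)" by auto
    then show ?thesis using T_const[of 0] by (simp add: A_mu_ae_iff_T_fixed)
  qed
  show "space M - A \<in> A_mu_ae M F" if "A \<in> A_mu_ae M F" for A
    using that T_fixed_Compl by (auto simp: A_mu_ae_iff_T_fixed)
  show "(\<Union>i. A i) \<in> A_mu_ae M F" if "range A \<subseteq> A_mu_ae M F" for A :: "nat \<Rightarrow> 'a set"
  proof -
    have "A i \<in> sets M" "AE x in M. T (indicator (A i)) x = indicator (A i) x" for i
      using that by (auto simp: image_subset_iff A_mu_ae_iff_T_fixed)
    then show ?thesis unfolding A_mu_ae_iff_T_fixed by (intro conjI T_fixed_UN) auto
  qed
qed

text \<open>The indicator of \<open>{g > c}\<close> is the increasing limit of the functions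
  \<open>min 1 (k * (g - c)\<^sup>+)\<close>, each of which is again a fixed point because \<open>T\<close> is positive and
  preserves integrals.\<close>

lemma T_fixed_superlevel:
  assumes g: "g \<in> Linf M" and fixed: "AE x in M. T g x = g x"
  shows "{x \<in> space M. c < g x} \<in> A_mu_ae M F"
proof -
  have [measurable]: "g \<in> borel_measurable M" using g by auto
  obtain d where d: "0 \<le> d" "AE x in M. \<bar>g x\<bar> \<le> d" using g by (rule Linf_boundedE)
  define A where "A = {x \<in> space M. c < g x}"
  have [measurable]: "A \<in> sets M" unfolding A_def by measurable
  define v where "v x = max 0 (g x - c)" for x
  have [measurable]: "v \<in> borel_measurable M" unfolding v_def by measurable
  have vL: "v \<in> Linf M"
    by (rule LinfI[of _ "d + \<bar>c\<bar>"]) (use d in \<open>auto simp: v_def elim!: eventually_mono\<close>)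
  \<comment> \<open>A maximum of fixed points lies below its image and a minimum lies above it.
    Hence \<open>v\<close> is treated with \<open>T_fixed_if_ge\<close> and \<open>w k\<close> below
    with \<open>T_fixed_if_le\<close>.\<close>
  have v: "AE x in M. T v x = v x"
  proof (rule T_fixed_if_ge[OF vL])
    have "AE x in M. T (\<lambda>x. g x - c) x \<le> T v x"
      by (rule T_mono) (use g vL in \<open>auto simp: v_def\<close>)
    moreover have "AE x in M. T (\<lambda>x. g x - c) x = T g x - T (\<lambda>x. c) x"
      by (rule T_diff) (use g in auto)
    moreover have "AE x in M. T (\<lambda>x. 0) x \<le> T v x"
      by (rule T_mono) (use vL in \<open>auto simp: v_def\<close>)
    ultimately show "AE x in M. v x \<le> T v x"
      using fixed T_const[of c] T_const[of 0] by eventually_elim (auto simp: v_def)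
  qed
  define w where "w k x = min 1 (real k * v x)" for k x
  have [measurable]: "w k \<in> borel_measurable M" for k unfolding w_def by measurable
  have wL: "w k \<in> Linf M" for k
    by (rule LinfI[of _ 1]) (auto simp: w_def v_def)
  have w: "AE x in M. T (w k) x = w k x" for k
  proof (rule T_fixed_if_le[OF wL])
    have "AE x in M. T (w k) x \<le> T (\<lambda>x. real k * v x) x"
      by (rule T_mono) (use wL vL in \<open>auto simp: w_def\<close>)
    moreover have "AE x in M. T (\<lambda>x. real k * v x) x = real k * T v x"
      by (rule T_cmult[OF vL])
    moreover have "AE x in M. T (w k) x \<le> T (\<lambda>x. 1) x"
      by (rule T_mono) (use wL in \<open>auto simp: w_def\<close>)
    ultimately show "AE x in M. T (w k) x \<le> w k x"
      using v T_const[of 1] by eventually_elim (auto simp: w_def)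
  qed
  have "AE x in M. \<forall>k. T (w k) x \<le> T (indicator A) x"
    unfolding AE_all_countable
  proof
    fix k
    show "AE x in M. T (w k) x \<le> T (indicator A) x"
    proof (rule T_mono[OF wL])
      show "AE x in M. w k x \<le> indicator A x"
        using AE_space by eventually_elim (auto simp: w_def v_def A_def indicator_def)
    qed auto
  qed
  moreover have "AE x in M. \<forall>k. T (w k) x = w k x"
    unfolding AE_all_countable using w by blast
  ultimately have "AE x in M. indicator A x \<le> T (indicator A) x"
  proof eventually_elim
    case (elim x)
    then have le: "w k x \<le> T (indicator A) x" for k by metis
    show ?case
    proof (cases "x \<in> A")
      case True
      then have "0 < v x" by (auto simp: A_def v_def)
      then obtain k where "1 < real k * v x" using reals_Archimedean3 by blast
      then show ?thesis using le[of k] True by (simp add: w_def)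
    next
      case False
      \<comment> \<open>Since \<open>w 0\<close> is zero, the index 0 supplies the lower bound
        zero.\<close>
      then show ?thesis using le[of 0] by (simp add: w_def)
    qed
  qed
  from T_fixed_if_ge[OF _ this] show ?thesis
    unfolding A_mu_ae_iff_T_fixed A_def[symmetric] by auto
qed

section \<open>The limit operator as a conditional expectation\<close>

text \<open>Conditional expectations are taken with respect to a \<open>measure\<close>, so the set
  system is wrapped into one; its measure function is irrelevant.\<close>

definition fixed_algebra :: "'a measure" where
  "fixed_algebra = sigma (space M) (A_mu_ae M F)"

lemma sets_fixed_algebra: "sets fixed_algebra = A_mu_ae M F"
  unfolding fixed_algebra_def by (rule sigma_algebra.sets_measure_of_eq[OF sigma_algebra_A_mu_ae])

lemma space_fixed_algebra: "space fixed_algebra = space M"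
  unfolding fixed_algebra_def by (rule space_measure_of_conv)

lemma subalgebra_fixed_algebra: "subalgebra M fixed_algebra"
  unfolding subalgebra_def sets_fixed_algebra space_fixed_algebra by (auto simp: A_mu_ae_def)

text \<open>By idempotence \<open>T f\<close> is a fixed point, so all its superlevel sets are fixed
  sets.\<close>

lemma T_measurable_fixed_algebra:
  assumes "f \<in> Linf M" shows "T f \<in> borel_measurable fixed_algebra"
  unfolding borel_measurable_iff_greater space_fixed_algebra sets_fixed_algebra
  using T_fixed_superlevel[OF T_Linf[OF assms] T_idem[OF assms]] by simp

text \<open>For a fixed set \<open>A\<close>, self-adjointness moves \<open>T\<close> from
  \<open>indicator A\<close>, where it does nothing, to \<open>f\<close>; so \<open>f\<close> and
  \<open>T f\<close> have the same integral over \<open>A\<close>.\<close>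

lemma cond_exp_fixed_algebra_eq_T:
  assumes f: "f \<in> Linf M" shows "AE x in M. real_cond_exp M fixed_algebra f x = T f x"
proof (rule sigma_finite_subalgebra.real_cond_exp_charact
    [OF sigma_finite_subalgebraI[OF subalgebra_fixed_algebra]])
  show "T f \<in> borel_measurable fixed_algebra" by (rule T_measurable_fixed_algebra[OF f])
  show "integrable M f" "integrable M (T f)" using f by auto
  fix A assume "A \<in> sets fixed_algebra"
  then have [measurable]: "A \<in> sets M" and A: "AE x in M. T (indicator A) x = indicator A x"
    by (auto simp: sets_fixed_algebra A_mu_ae_iff_T_fixed)
  have "(\<integral>x. T (indicator A) x * f x \<partial>M) = (\<integral>x. indicator A x * T f x \<partial>M)"
    by (rule T_self_adjoint) (use f in auto)
  moreover have "(\<integral>x. T (indicator A) x * f x \<partial>M) = (\<integral>x. indicator A x * f x \<partial>M)"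
    by (rule integral_cong_AE) (use f A in \<open>auto simp: Linf_measurable\<close>)
  ultimately show "(\<integral>x\<in>A. f x \<partial>M) = (\<integral>x\<in>A. T f x \<partial>M)"
    by (simp add: set_lebesgue_integral_def)
qed

section \<open>Orthogonality and the minimum of the family\<close>

text \<open>By self-adjointness \<open>\<langle>f, h\<rangle>\<close> is the integral of a function which equals \<open>E j f\<close> on \<open>B j\<close>;
  as the \<open>B j\<close> are disjoint, dominated convergence applies.\<close>

lemma W_perp_ae_if_T_zero:
  assumes f: "f \<in> Linf M" and zero: "AE x in M. T f x = 0"
  shows "f \<in> W_perp_ae M F"
  unfolding W_perp_ae_def
proof (intro CollectI conjI allI impI)
  show "f \<in> Linf M" by fact
  fix N :: "nat \<Rightarrow> nat" and h
  assume N: "strict_mono N" and "\<forall>k. h k \<in> C_set M F (N k)"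
  then have "\<forall>k. \<exists>B. (\<forall>j\<ge>N k. B j \<in> sets M) \<and> disjoint_family_on B {N k..} \<and>
            finite {j. N k \<le> j \<and> B j \<noteq> {}} \<and>
            h k = (\<lambda>x. \<Sum>j | N k \<le> j \<and> B j \<noteq> {}. E j (indicator (B j)) x)"
    unfolding C_set_def by blast
  then obtain B where B0: "\<forall>k. (\<forall>j\<ge>N k. B k j \<in> sets M) \<and> disjoint_family_on (B k) {N k..} \<and>
            finite {j. N k \<le> j \<and> B k j \<noteq> {}} \<and>
            h k = (\<lambda>x. \<Sum>j | N k \<le> j \<and> B k j \<noteq> {}. E j (indicator (B k j)) x)"
    by (rule choice[THEN exE])
  define J where "J k = {j. N k \<le> j \<and> B k j \<noteq> {}}" for k
  have B: "\<And>k j. j \<in> J k \<Longrightarrow> B k j \<in> sets M"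
    and disj: "\<And>k. disjoint_family_on (B k) (J k)"
    and fin: "\<And>k. finite (J k)"
    and h: "\<And>k. h k = (\<lambda>x. \<Sum>j\<in>J k. E j (indicator (B k j)) x)"
    using B0 by (auto simp: J_def disjoint_family_on_def)
  define u where "u k x = (\<Sum>j\<in>J k. E j f x * indicator (B k j) x)" for k x
  have [measurable]: "u k \<in> borel_measurable M" for k
    unfolding u_def using B by (intro borel_measurable_sum borel_measurable_times borel_measurable_indicator) auto
  have int_u: "(\<integral>x. f x * h k x \<partial>M) = (\<integral>x. u k x \<partial>M)" for k
  proof -
    have "(\<integral>x. f x * h k x \<partial>M) = (\<integral>x. (\<Sum>j\<in>J k. f x * E j (indicator (B k j)) x) \<partial>M)"
      by (simp add: h sum_distrib_left)
    also have "\<dots> = (\<Sum>j\<in>J k. \<integral>x. f x * E j (indicator (B k j)) x \<partial>M)"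
      using f B by (intro Bochner_Integration.integral_sum Linf_integrable Linf_mult E_Linf Linf_indicator)
    also have "\<dots> = (\<Sum>j\<in>J k. \<integral>x. E j f x * indicator (B k j) x \<partial>M)"
      using f B by (intro sum.cong cond_exp_self_adjoint[symmetric] subalg) auto
    also have "\<dots> = (\<integral>x. u k x \<partial>M)"
      unfolding u_def using f B
      by (intro Bochner_Integration.integral_sum[symmetric] Linf_integrable Linf_mult E_Linf Linf_indicator)
    finally show ?thesis .
  qed
  have u_cases: "u k x = 0 \<or> (\<exists>j\<ge>N k. u k x = E j f x)" for k x
  proof (cases "\<exists>j\<in>J k. x \<in> B k j")
    case True
    then obtain j where j: "j \<in> J k" "x \<in> B k j" by auto
    have "u k x = (\<Sum>i\<in>J k. if i = j then E j f x else 0)"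
      unfolding u_def using j disj[of k]
      by (intro sum.cong) (auto simp: indicator_def disjoint_family_on_def)
    then have "u k x = E j f x" using j fin by simp
    then show ?thesis using j by (auto simp: J_def)
  next
    case False
    then have "u k x = 0" unfolding u_def by (intro sum.neutral) auto
    then show ?thesis by simp
  qed
  obtain c where c: "0 \<le> c" "AE x in M. \<bar>f x\<bar> \<le> c" using f by (rule Linf_boundedE)
  have "(\<lambda>k. \<integral>x. u k x \<partial>M) \<longlonglongrightarrow> (\<integral>x. 0 \<partial>M)"
  proof (rule integral_dominated_convergence[where w = "\<lambda>x. c"])
    show "AE x in M. (\<lambda>k. u k x) \<longlonglongrightarrow> 0"
      using E_tendsto_T[OF f] zero
    proof eventually_elim
      case (elim x)
      then have lim: "(\<lambda>n. E n f x) \<longlonglongrightarrow> 0" by simp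
      show ?case
      proof (rule LIMSEQ_I)
        fix r :: real assume "0 < r"
        then obtain n0 where n0: "\<And>n. n \<ge> n0 \<Longrightarrow> norm (E n f x - 0) < r"
          using LIMSEQ_D[OF lim] by blast
        show "\<exists>n0. \<forall>k\<ge>n0. norm (u k x - 0) < r"
        proof (intro exI allI impI)
          fix k assume "n0 \<le> k"
          \<comment> \<open>A strictly increasing \<open>N\<close> satisfies
            \<open>k \<le> N k\<close>, so every index that \<open>u k x\<close> can pick is at
            least \<open>n0\<close>.\<close>
          then have "n0 \<le> N k" using strict_mono_imp_increasing[OF N, of k] by linarith
          then show "norm (u k x - 0) < r"
            using u_cases[of k x] n0 \<open>0 < r\<close> by force
        qed
      qed
    qed
    show "AE x in M. norm (u k x) \<le> c" for k
      using AE_all_E_abs_le[OF f c(2)]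
    proof eventually_elim
      case (elim x)
      then show ?case using u_cases[of k x] c(1) by auto
    qed
  qed auto
  then show "(\<lambda>k. \<integral>x. f x * h k x \<partial>M) \<longlonglongrightarrow> 0" by (simp add: int_u)
qed

text \<open>The residual of \<open>f\<close> is a.e. \<open>f - T f\<close>, which \<open>T\<close>
  annihilates by idempotence.\<close>

lemma fixed_algebra_in_D_family: "fixed_algebra \<in> D_family M F"
  unfolding D_family_def
proof (intro CollectI conjI ballI)
  show "subalgebra M fixed_algebra" by (rule subalgebra_fixed_algebra)
  fix f assume f: "f \<in> Linf M"
  note EL = cond_exp_Linf[OF subalgebra_fixed_algebra f]
  have "AE x in M. T (\<lambda>x. f x - real_cond_exp M fixed_algebra f x) x
      = T f x - T (real_cond_exp M fixed_algebra f) x"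
    by (rule T_diff[OF f EL])
  moreover have "AE x in M. T (real_cond_exp M fixed_algebra f) x = T (T f) x"
    by (rule T_cong[OF EL T_Linf[OF f] cond_exp_fixed_algebra_eq_T[OF f]])
  ultimately have "AE x in M. T (\<lambda>x. f x - real_cond_exp M fixed_algebra f x) x = 0"
    using T_idem[OF f] by eventually_elim simp
  then show "cond_exp_perp M fixed_algebra f \<in> W_perp_ae M F"
    unfolding cond_exp_perp_def by (intro W_perp_ae_if_T_zero Linf_diff f EL)
qed

text \<open>The single terms \<open>E k (indicator A)\<close> lie in \<open>C_set M F k\<close>.
  Their pairings with \<open>f\<close> tend to zero, but also to the pairing of \<open>f\<close>
  with \<open>T (indicator A) = indicator A\<close>.\<close>

lemma W_perp_ae_orthogonal:
  assumes f: "f \<in> W_perp_ae M F" and A: "A \<in> A_mu_ae M F"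
  shows "(\<integral>x. f x * indicator A x \<partial>M) = 0"
proof -
  have fL: "f \<in> Linf M" using f by (simp add: W_perp_ae_def)
  have [measurable]: "A \<in> sets M" and fixed: "AE x in M. T (indicator A) x = indicator A x"
    using A by (auto simp: A_mu_ae_iff_T_fixed)
  \<comment> \<open>\<open>C_set\<close> omits empty sets from its sum, so for \<open>A = {}\<close>
    the admissible function is exactly zero instead of a version of
    \<open>E k (indicator {})\<close>.\<close>
  define h where "h k = (if A = {} then (\<lambda>x. 0) else E k (indicator A))" for k
  have "h k \<in> C_set M F k" for k
  proof -
    define B where "B j = (if j = k then A else {})" for j
    have *: "{j. k \<le> j \<and> B j \<noteq> {}} = (if A = {} then {} else {k})" by (auto simp: B_def)
    have "h k = (\<lambda>x. \<Sum>j | k \<le> j \<and> B j \<noteq> {}. E j (indicator (B j)) x)"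
      unfolding * h_def by (auto simp: B_def)
    moreover have "\<forall>j\<ge>k. B j \<in> sets M" "disjoint_family_on B {k..}"
      by (auto simp: B_def disjoint_family_on_def)
    moreover have "finite {j. k \<le> j \<and> B j \<noteq> {}}" unfolding * by simp
    ultimately show ?thesis unfolding C_set_def by blast
  qed
  then have "(\<lambda>k. \<integral>x. f x * h k x \<partial>M) \<longlonglongrightarrow> 0"
    using f unfolding W_perp_ae_def by (auto dest!: spec[of _ id] simp: strict_mono_def)
  moreover have "(\<integral>x. f x * h k x \<partial>M) = (\<integral>x. E k (indicator A) x * f x \<partial>M)" for k
  proof (cases "A = {}")
    case True
    have "AE x in M. E k (indicator A) x = indicator A x"
      unfolding True by (rule sigma_finite_subalgebra.real_cond_exp_F_meas[OF sfs]) auto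
    then have "(\<integral>x. E k (indicator A) x * f x \<partial>M) = (\<integral>x. indicator A x * f x \<partial>M)"
      by (intro integral_cong_AE) (use fL in \<open>auto simp: Linf_measurable\<close>)
    then show ?thesis using True by (simp add: h_def)
  qed (simp add: h_def mult.commute)
  ultimately have "(\<integral>x. T (indicator A) x * f x \<partial>M) = 0"
    using LIMSEQ_unique[OF integral_E_mult_tendsto[OF Linf_indicator fL]] by auto
  moreover have "(\<integral>x. T (indicator A) x * f x \<partial>M) = (\<integral>x. f x * indicator A x \<partial>M)"
    by (rule integral_cong_AE) (use fixed fL in \<open>auto simp: Linf_measurable mult.commute\<close>)
  ultimately show ?thesis by simp
qed

text \<open>The residual \<open>k = \<chi>\<^sub>A - \<E>(\<chi>\<^sub>A|C)\<close> is orthogonal both to \<open>\<chi>\<^sub>A\<close>, since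
  it lies in \<open>W_perp_ae M F\<close>, and to \<open>\<E>(\<chi>\<^sub>A|C)\<close>, hence to itself.\<close>

lemma A_mu_ae_included_D_family:
  assumes C: "C \<in> D_family M F"
  shows "ae_included M (A_mu_ae M F) (sets C)"
  unfolding ae_included_def
proof
  fix A assume A: "A \<in> A_mu_ae M F"
  then have AM [measurable]: "A \<in> sets M" by (simp add: A_mu_ae_def)
  have sub: "subalgebra M C" using C by (simp add: D_family_def)
  note s = sigma_finite_subalgebraI[OF sub]
  define q where "q = real_cond_exp M C (indicator A)"
  have qL: "q \<in> Linf M" unfolding q_def using sub by auto
  have [measurable]: "q \<in> borel_measurable M" using qL by auto
  define k where "k = (\<lambda>x. indicator A x - q x)"
  have kL: "k \<in> Linf M" unfolding k_def using qL by auto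
  have "cond_exp_perp M C (indicator A) \<in> W_perp_ae M F" using C by (simp add: D_family_def)
  then have "k \<in> W_perp_ae M F" by (simp add: cond_exp_perp_def k_def q_def)
  then have 1: "(\<integral>x. k x * indicator A x \<partial>M) = 0" using A by (rule W_perp_ae_orthogonal)
  have qq: "AE x in M. real_cond_exp M C q x = q x"
    by (rule sigma_finite_subalgebra.real_cond_exp_F_meas[OF s]) (use qL in \<open>auto simp: q_def\<close>)
  have "(\<integral>x. q x * q x \<partial>M) = (\<integral>x. indicator A x * real_cond_exp M C q x \<partial>M)"
    using cond_exp_self_adjoint[OF sub Linf_indicator[OF AM] qL] by (simp add: q_def)
  also have "\<dots> = (\<integral>x. indicator A x * q x \<partial>M)"
    by (rule integral_cong_AE) (use qq cond_exp_Linf[OF sub qL] in \<open>auto simp: Linf_measurable\<close>)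
  finally have 2: "(\<integral>x. q x * q x \<partial>M) = (\<integral>x. indicator A x * q x \<partial>M)" .
  have 3: "(\<integral>x. k x * q x \<partial>M) = (\<integral>x. indicator A x * q x \<partial>M) - (\<integral>x. q x * q x \<partial>M)"
    unfolding k_def left_diff_distrib
    by (rule Bochner_Integration.integral_diff) (use qL in \<open>auto intro!: Linf_integrable Linf_mult\<close>)
  have "(\<integral>x. k x * k x \<partial>M) = 0"
  proof -
    have "(\<integral>x. k x * k x \<partial>M) = (\<integral>x. k x * indicator A x - k x * q x \<partial>M)"
      by (simp add: k_def right_diff_distrib)
    also have "\<dots> = (\<integral>x. k x * indicator A x \<partial>M) - (\<integral>x. k x * q x \<partial>M)"
      by (rule Bochner_Integration.integral_diff) (use qL kL in \<open>auto intro!: Linf_integrable Linf_mult\<close>)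
    finally show ?thesis using 1 2 3 by simp
  qed
  then have "AE x in M. k x * k x = 0"
    by (subst (asm) integral_nonneg_eq_0_iff_AE) (use kL in auto)
  then have eq: "AE x in M. q x = indicator A x"
    by eventually_elim (simp add: k_def)
  \<comment> \<open>As \<open>q\<close> takes a.e. only the values 0 and 1, a threshold strictly
    between them recovers \<open>A\<close> modulo a null set, now as a set of
    \<open>C\<close>.\<close>
  define S where "S = {x \<in> space C. 1/2 < q x}"
  have SC: "S \<in> sets C" unfolding S_def q_def by measurable
  then have [measurable]: "S \<in> sets M" using sub by (auto simp: subalgebra_def)
  have "AE x in M. x \<in> A \<longleftrightarrow> x \<in> S"
    using eq AE_space
    by eventually_elim (use sub in \<open>auto simp: S_def subalgebra_def indicator_def split: if_splits\<close>)
  then have "ae_eq_set M A S" by (subst ae_eq_set_iff_AE) auto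
  with SC show "\<exists>S\<in>sets C. ae_eq_set M A S" by blast
qed

end

theorem theorem4p22:
  fixes M :: "'a measure" and F :: "nat \<Rightarrow> 'a measure"
  assumes "prob_space M"
    and "\<And>n. subalgebra M (F n)"
    and "\<And>f. f \<in> Linf M \<Longrightarrow> AE x in M. convergent (\<lambda>n. real_cond_exp M (F n) f x)"
  shows "sigma_algebra (space M) (A_mu_ae M F) \<and> A_mu_ae M F \<subseteq> sets M \<and>
    (\<exists>P. is_ae_minimum M (D_family M F) P) \<and>
    (\<forall>P. is_ae_minimum M (D_family M F) P \<longrightarrow> ae_equal M (A_mu_ae M F) (sets P))"
proof -
  interpret ae_convergent_subalgebras M F
    using assms by (intro ae_convergent_subalgebras.intro ae_convergent_subalgebras_axioms.intro)
  have "is_ae_minimum M (D_family M F) fixed_algebra"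
    unfolding is_ae_minimum_def sets_fixed_algebra
    using fixed_algebra_in_D_family A_mu_ae_included_D_family by blast
  \<comment> \<open>Any minimum \<open>P\<close> is included in the member
    \<open>fixed_algebra\<close> of the family, while \<open>A_mu_ae M F\<close> is included in
    every member, in particular in \<open>P\<close>.\<close>
  moreover have "ae_equal M (A_mu_ae M F) (sets P)" if "is_ae_minimum M (D_family M F) P" for P
    using that fixed_algebra_in_D_family A_mu_ae_included_D_family
    unfolding is_ae_minimum_def ae_equal_def sets_fixed_algebra[symmetric] by blast
  ultimately show ?thesis using sigma_algebra_A_mu_ae by (auto simp: A_mu_ae_def)
qed

end
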